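(* For any $t>0$, the primal and dual central path points $x_t$ and $y_t$ satisfy $$\lambda_g^2(x_t)+\lambda_\zeta^2(y_t)=\nu.$$
   Context: $\mathbb E$ is a finite-dimensional real vector space with dual space $\mathbb E^*$; $\langle s,x\rangle$ is the value of $s\in\mathbb E^*$ at $x\in\mathbb E$. $K\subset\mathbb E$ is a closed convex pointed cone with nonempty interior, $K^*=\{s\in\mathbb E^*:\langle s,x\rangle\ge0\ \forall x\in K\}$. A self-concordant function is a closed convex three times differentiable function $f$ with open domain such that $D^3f(x)[h]^3\le 2(D^2f(x)[h]^2)^{3/2}$. $F$ is a $\nu$-normal (regular) barrier for $K$: a self-concordant function with domain $\mathrm{int}\,K$, tending to $+\infty$ at the boundary, with $F(\tau x)=F(x)-\nu\ln\tau$ for $\tau>0$ ($\nu\ge1$). Its dual barrier is $F_*(s)=\max_{x\in\mathrm{int}\,K}[-\langle s,x\rangle-F(x)]$, $s\in\mathrm{int}\,K^*$. $A:\mathbb E\to\mathbb R^m$ is linear with adjoint $A^*:\mathbb R^m\to\mathbb E^*$, $b\in\mathbb R^m\setminus\{0\}$, $c\in\mathbb E^*$; $(A^*,c):\mathbb R^{m+1}\to\mathbb E^*$ is injective, and there exists $(\tilde x,\tilde y,\tilde s)\in\mathrm{int}\,K\times\mathbb R^m\times\mathrm{int}\,K^*$ with $A\tilde x=b$, $\tilde s+A^*\tilde y=c$. Central paths: $x_t=\arg\min\{t\langle c,x\rangle+F(x):x\in\mathrm{int}\,K,\ Ax=b\}$ and $(y_t,s_t)=\arg\max\{t\langle b,y\rangle-F_*(s):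 s\in\mathrm{int}\,K^*,\ s+A^*y=c\}$. $g$ is the restriction of $F$ to the relative interior of the primal feasible set $\{x\in K:Ax=b\}$, and $\lambda_g(x)=\max\{\langle\nabla F(x),h\rangle: h\in\mathbb E,\ Ah=0,\ \langle\nabla^2F(x)h,h\rangle\le1\}$, i.e. $-\frac12\lambda_g^2(x)=\min_{Ah=0}\{\langle\nabla F(x),h\rangle+\frac12\langle\nabla^2F(x)h,h\rangle\}$. $\zeta(y)=F_*(c-A^*y)$ on $\{y: c-A^*y\in\mathrm{int}\,K^*\}$, and $\lambda_\zeta(y)=\langle\nabla\zeta(y),[\nabla^2\zeta(y)]^{-1}\nabla\zeta(y)\rangle^{1/2}$. *)

theory Defs
  imports "HOL-Analysis.Analysis"
begin

(* The dual space of a Euclidean space 'a is the type 'a =>L real of (bounded) linear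
   functionals, with the operator norm; <s, x> is the application blinfun_apply s x. *)

definition dual_cone :: "'a::euclidean_space set \<Rightarrow> ('a \<Rightarrow>\<^sub>L real) set"
  where "dual_cone K = {s :: 'a \<Rightarrow>\<^sub>L real. \<forall>x\<in>K. 0 \<le> s x}"

definition proper_cone :: "'a::euclidean_space set \<Rightarrow> bool"
  where "proper_cone K \<longleftrightarrow>
    closed K \<and> convex K \<and> cone K \<and> (\<forall>x. x \<in> K \<and> - x \<in> K \<longrightarrow> x = 0) \<and> interior K \<noteq> {}"

(* The Frechet derivative as a bounded linear map, so that it can be iterated:
   fderiv f x is the gradient (an element of the dual space) of a real-valued f,
   fderiv (fderiv f) x is its Hessian, as a map into the dual space, and
   D^3 f(x)[h]^3 is fderiv (fderiv (fderiv f)) x h h h. *)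
definition fderiv ::
    "('a::real_normed_vector \<Rightarrow> 'b::real_normed_vector) \<Rightarrow> 'a \<Rightarrow> 'a \<Rightarrow>\<^sub>L 'b"
  where "fderiv f x = Blinfun (frechet_derivative f (at x))"

definition thrice_differentiable_on ::
    "('a::real_normed_vector \<Rightarrow> real) \<Rightarrow> 'a set \<Rightarrow> bool"
  where "thrice_differentiable_on f S \<longleftrightarrow>
    (\<forall>x\<in>S. f differentiable (at x) \<and> fderiv f differentiable (at x) \<and>
       fderiv (fderiv f) differentiable (at x))"

(* S is the domain of f; values of f outside S are irrelevant. A convex function is closed
   if its epigraph is. *)
definition self_concordant_on :: "'a::euclidean_space set \<Rightarrow> ('a \<Rightarrow> real) \<Rightarrow> bool"
  where "self_concordant_on S f \<longleftrightarrow>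
    open S \<and> convex_on S f \<and> closed (epigraph S f) \<and> thrice_differentiable_on f S \<and>
    (\<forall>x\<in>S. \<forall>h. fderiv (fderiv (fderiv f)) x h h h
       \<le> 2 * (fderiv (fderiv f) x h h) powr (3/2))"

definition normal_barrier :: "'a::euclidean_space set \<Rightarrow> real \<Rightarrow> ('a \<Rightarrow> real) \<Rightarrow> bool"
  where "normal_barrier K \<nu> F \<longleftrightarrow>
    1 \<le> \<nu> \<and>
    self_concordant_on (interior K) F \<and>
    (\<forall>x\<in>frontier K. filterlim F at_top (at x within interior K)) \<and>
    (\<forall>x\<in>interior K. \<forall>\<tau>>0. F (\<tau> *\<^sub>R x) = F x - \<nu> * ln \<tau>)"

(* The supremum is a maximum for every s in the interior of the dual cone, which is where
   the dual barrier is used. *)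
definition dual_barrier :: "'a::euclidean_space set \<Rightarrow> ('a \<Rightarrow> real) \<Rightarrow> ('a \<Rightarrow>\<^sub>L real) \<Rightarrow> real"
  where "dual_barrier K F s = (SUP x\<in>interior K. - s x - F x)"

definition adj :: "('a::euclidean_space \<Rightarrow>\<^sub>L (real ^ 'm)) \<Rightarrow> real ^ 'm \<Rightarrow> 'a \<Rightarrow>\<^sub>L real"
  where "adj A y = Blinfun (\<lambda>x. y \<bullet> blinfun_apply A x)"

definition primal_path ::
    "'a::euclidean_space set \<Rightarrow> ('a \<Rightarrow> real) \<Rightarrow> ('a \<Rightarrow>\<^sub>L (real ^ 'm)) \<Rightarrow> real ^ 'm \<Rightarrow> ('a \<Rightarrow>\<^sub>L real)
      \<Rightarrow> real \<Rightarrow> 'a"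
  where "primal_path K F A b c t =
    arg_min (\<lambda>x. t * c x + F x) (\<lambda>x. x \<in> interior K \<and> A x = b)"

definition dual_path ::
    "'a::euclidean_space set \<Rightarrow> ('a \<Rightarrow> real) \<Rightarrow> ('a \<Rightarrow>\<^sub>L (real ^ 'm)) \<Rightarrow> real ^ 'm \<Rightarrow> ('a \<Rightarrow>\<^sub>L real)
      \<Rightarrow> real \<Rightarrow> (real ^ 'm) \<times> ('a \<Rightarrow>\<^sub>L real)"
  where "dual_path K F A b c t =
    arg_max (\<lambda>(y, s). t * (b \<bullet> y) - dual_barrier K F s)
      (\<lambda>(y, s). s \<in> interior (dual_cone K) \<and> s + adj A y = c)"

(* The Newton decrement of the restriction of F to the affine set {x. A x = b}; it depends
   on this set only through the kernel of A. *)
definition lambda_g :: "('a::euclidean_space \<Rightarrow> real) \<Rightarrow> ('a \<Rightarrow>\<^sub>L (real ^ 'm)) \<Rightarrow> 'a \<Rightarrow> real"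
  where "lambda_g F A x = Sup {fderiv F x h |h. A h = 0 \<and> fderiv (fderiv F) x h h \<le> 1}"

definition zeta ::
    "'a::euclidean_space set \<Rightarrow> ('a \<Rightarrow> real) \<Rightarrow> ('a \<Rightarrow>\<^sub>L (real ^ 'm)) \<Rightarrow> ('a \<Rightarrow>\<^sub>L real)
      \<Rightarrow> real ^ 'm \<Rightarrow> real"
  where "zeta K F A c y = dual_barrier K F (c - adj A y)"

(* The Hessian maps real ^ 'm to its dual, so its inverse applied to the gradient is a
   vector, which the gradient can then be evaluated at. *)
definition lambda_zeta ::
    "'a::euclidean_space set \<Rightarrow> ('a \<Rightarrow> real) \<Rightarrow> ('a \<Rightarrow>\<^sub>L (real ^ 'm)) \<Rightarrow> ('a \<Rightarrow>\<^sub>L real)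
      \<Rightarrow> real ^ 'm \<Rightarrow> real"
  where "lambda_zeta K F A c y =
    (let \<zeta> = zeta K F A c
     in sqrt (fderiv \<zeta> y (inv (blinfun_apply (fderiv (fderiv \<zeta>) y)) (fderiv \<zeta> y))))"

end

theory Submission
  imports Defs
begin

text \<open>
  Fix a central point \<open>x\<close> and work at \<open>u = t x\<close>, with the inner product \<open>H = F''(u)\<close>.
  Logarithmic homogeneity gives \<open>H u = - F'(u)\<close> and \<open>F'(u) u = - \<nu>\<close>, hence \<open>H u u = \<nu>\<close>: the
  squared length of \<open>u\<close> is \<open>\<nu>\<close>. Split \<open>u = p + q\<close> with \<open>q\<close> in the kernel of \<open>A\<close> and \<open>p\<close> orthogonal to
  it, so that \<open>H p\<close> lies in the range of the adjoint of \<open>A\<close>. The two Newton decrements are the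
  lengths of these two components, and the theorem is Pythagoras.

  For the primal decrement, \<open>F'(u) = - H u\<close> restricted to the kernel of \<open>A\<close> is \<open>- H q\<close>, whose dual
  norm is the length of \<open>q\<close> (\<open>lambda_g_eq\<close>); passing between \<open>x\<close> and \<open>t x\<close> does not change it
  (\<open>lambda_g_scale\<close>). For the dual decrement, the dual barrier is differentiable with gradient
  minus the maximiser \<open>z\<close> in its definition, which is the solution of \<open>F'(z) = - s\<close>; so its Hessian
  is the inverse of \<open>F''(z)\<close>. At the dual central point the solution is \<open>z = u\<close>,
  so \<open>\<zeta>\<close> has gradient \<open>A u\<close> and Hessian \<open>A H\<^sup>-\<^sup>1 A\<^sup>*\<close> there, and its decrement is the length of \<open>p\<close>
  (\<open>lambda_zeta_eq\<close>).

  Two facts about the barrier carry this computation. The Hessian is positive definite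
  (\<open>hess_pos\<close>): where it degenerated in a direction, self-concordance would make \<open>F\<close> affine along
  the line in that direction, and this line has to leave the pointed cone, although \<open>F\<close> blows up
  at the boundary. And the central paths exist with \<open>s\<^sub>t = - F'(t x\<^sub>t)\<close>: the primal problem is coercive because there
  is a strictly feasible dual point (\<open>coercive\<close>), stationarity of its minimiser provides a dual
  feasible point of the form \<open>- F'(t x\<^sub>t)\<close>, and equality in weak duality shows that it is the only
  dual maximiser (\<open>dual_path_eq\<close>).
\<close>

section \<open>Derivatives along lines and symmetry of the Hessian\<close>

lemma has_derivative_fderiv:
  assumes "f differentiable (at x)"
  shows "(f has_derivative blinfun_apply (fderiv f x)) (at x)"
proof -
  have *: "(f has_derivative frechet_derivative f (at x)) (at x)"
    using assms frechet_derivative_works by blast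
  then have "bounded_linear (frechet_derivative f (at x))"
    by (rule has_derivative_bounded_linear)
  with * show ?thesis
    by (simp add: fderiv_def bounded_linear_Blinfun_apply)
qed

lemma fderiv_eqI:
  assumes "(f has_derivative blinfun_apply f') (at x)"
  shows "fderiv f x = f'"
  by (metis assms blinfun_apply_inverse fderiv_def frechet_derivative_at)

lemma has_vector_derivative_along_line:
  fixes f :: "'a::real_normed_vector \<Rightarrow> 'b::real_normed_vector"
  assumes "(f has_derivative f') (at (x + s *\<^sub>R h))"
  shows "((\<lambda>s. f (x + s *\<^sub>R h)) has_vector_derivative f' h) (at s)"
proof -
  have "((\<lambda>s. x + s *\<^sub>R h) has_derivative (\<lambda>r. r *\<^sub>R h)) (at s)"
    by (auto intro!: derivative_eq_intros)
  from diff_chain_at[OF this assms]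
  have "((\<lambda>s. f (x + s *\<^sub>R h)) has_derivative (\<lambda>r. f' (r *\<^sub>R h))) (at s)"
    by (simp add: o_def)
  moreover have "f' (r *\<^sub>R h) = r *\<^sub>R f' h" for r
    using has_derivative_bounded_linear[OF assms] by (simp add: linear_simps)
  ultimately show ?thesis
    by (simp add: has_vector_derivative_def)
qed

lemma fderiv_along_line:
  fixes f :: "'a::real_normed_vector \<Rightarrow> real"
  assumes "f differentiable (at (x + s *\<^sub>R h))"
  shows "((\<lambda>s. f (x + s *\<^sub>R h)) has_real_derivative fderiv f (x + s *\<^sub>R h) h) (at s)"
  using has_vector_derivative_along_line[OF has_derivative_fderiv[OF assms]]
  by (simp add: has_real_derivative_iff_has_vector_derivative)

lemma fderiv_along_line_apply:
  fixes G :: "'a::real_normed_vector \<Rightarrow> 'b::real_normed_vector \<Rightarrow>\<^sub>L 'c::real_normed_vector"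
  assumes "G differentiable (at (x + s *\<^sub>R h))"
  shows "((\<lambda>s. G (x + s *\<^sub>R h) u) has_vector_derivative fderiv G (x + s *\<^sub>R h) h u) (at s)"
  using bounded_linear.has_vector_derivative[OF blinfun.bounded_linear_left
        has_vector_derivative_along_line[OF has_derivative_fderiv[OF assms]]] .

text \<open>
  The mean value theorem, applied first in direction \<open>u\<close> and then in direction \<open>v\<close>, turns the
  second difference over a small parallelogram into a Hessian value. The second difference is
  symmetric in \<open>u\<close> and \<open>v\<close>, which is why a continuous Hessian is symmetric as well.
\<close>
lemma second_difference_eq_hessian:
  fixes f :: "'a::real_normed_vector \<Rightarrow> real"
  assumes f: "\<And>z. z \<in> ball x d \<Longrightarrow> f differentiable (at z)"
    and f': "\<And>z. z \<in> ball x d \<Longrightarrow> fderiv f differentiable (at z)"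
    and s: "0 < s" "s * (norm u + norm v) < d"
  obtains z where "z \<in> ball x d"
    "f (x + s *\<^sub>R u + s *\<^sub>R v) - f (x + s *\<^sub>R u) - f (x + s *\<^sub>R v) + f x
      = s\<^sup>2 * fderiv (fderiv f) z v u"
proof -
  have mem: "x + p *\<^sub>R u + q *\<^sub>R v \<in> ball x d" if "0 \<le> p" "p \<le> s" "0 \<le> q" "q \<le> s" for p q
  proof -
    have "norm (p *\<^sub>R u + q *\<^sub>R v) \<le> p * norm u + q * norm v"
      by (rule norm_triangle_le) (use that in simp)
    also have "\<dots> \<le> s * norm u + s * norm v"
      using that by (intro add_mono mult_right_mono) auto
    also have "\<dots> < d" using s(2) by (simp add: distrib_left)
    finally have "norm (p *\<^sub>R u + q *\<^sub>R v) < d" .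
    moreover have "dist x (x + p *\<^sub>R u + q *\<^sub>R v) = norm (p *\<^sub>R u + q *\<^sub>R v)"
      unfolding dist_norm norm_minus_commute[of x] by (simp add: add.assoc)
    ultimately show ?thesis by simp
  qed
  define \<phi> where "\<phi> p = f ((x + s *\<^sub>R v) + p *\<^sub>R u) - f (x + p *\<^sub>R u)" for p
  have "(\<phi> has_real_derivative fderiv f ((x + s *\<^sub>R v) + p *\<^sub>R u) u - fderiv f (x + p *\<^sub>R u) u) (at p)"
    if "0 \<le> p" "p \<le> s" for p
    unfolding \<phi>_def using mem[of p s] mem[of p 0] that s
    by (intro DERIV_diff fderiv_along_line f) (auto simp: algebra_simps)
  from MVT2[OF s(1) this] obtain p where p: "0 < p" "p < s"
    and 1: "\<phi> s - \<phi> 0 = s * (fderiv f ((x + s *\<^sub>R v) + p *\<^sub>R u) u - fderiv f (x + p *\<^sub>R u) u)"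
    by auto
  define \<psi> where "\<psi> q = fderiv f ((x + p *\<^sub>R u) + q *\<^sub>R v) u" for q
  have "(\<psi> has_real_derivative fderiv (fderiv f) ((x + p *\<^sub>R u) + q *\<^sub>R v) v u) (at q)"
    if "0 \<le> q" "q \<le> s" for q
    unfolding \<psi>_def has_real_derivative_iff_has_vector_derivative using mem[of p q] that p
    by (intro fderiv_along_line_apply f') auto
  from MVT2[OF s(1) this] obtain q where q: "0 < q" "q < s"
    and 2: "\<psi> s - \<psi> 0 = s * fderiv (fderiv f) ((x + p *\<^sub>R u) + q *\<^sub>R v) v u"
    by auto
  show ?thesis
  proof
    show "x + p *\<^sub>R u + q *\<^sub>R v \<in> ball x d" using mem p q by auto
    show "f (x + s *\<^sub>R u + s *\<^sub>R v) - f (x + s *\<^sub>R u) - f (x + s *\<^sub>R v) + f x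
      = s\<^sup>2 * fderiv (fderiv f) (x + p *\<^sub>R u + q *\<^sub>R v) v u"
      using 1 2 unfolding \<phi>_def \<psi>_def by (simp add: power2_eq_square algebra_simps)
  qed
qed

lemma hessian_symmetric:
  fixes f :: "'a::real_normed_vector \<Rightarrow> real"
  assumes S: "open S" "x \<in> S"
    and f: "\<And>z. z \<in> S \<Longrightarrow> f differentiable (at z)"
    and f': "\<And>z. z \<in> S \<Longrightarrow> fderiv f differentiable (at z)"
    and cont: "continuous (at x) (fderiv (fderiv f))"
  shows "fderiv (fderiv f) x u v = fderiv (fderiv f) x v u"
proof -
  let ?H = "fderiv (fderiv f)"
  have close: "\<bar>?H x u v - ?H x v u\<bar> < e" if "0 < e" for e
  proof -
    have "((\<lambda>z. ?H z a b) \<longlongrightarrow> ?H x a b) (at x)" for a b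
      using cont unfolding continuous_within by (intro tendsto_intros)
    then have ev: "\<forall>\<^sub>F z in at x. dist (?H z a b) (?H x a b) < e/2" for a b
      using half_gt_zero[OF \<open>0 < e\<close>] unfolding tendsto_iff by blast
    obtain d1 where d1: "0 < d1" "\<And>z. z \<noteq> x \<Longrightarrow> dist z x < d1 \<Longrightarrow> dist (?H z u v) (?H x u v) < e/2"
      using ev[of u v] by (auto simp: eventually_at)
    obtain d2 where d2: "0 < d2" "\<And>z. z \<noteq> x \<Longrightarrow> dist z x < d2 \<Longrightarrow> dist (?H z v u) (?H x v u) < e/2"
      using ev[of v u] by (auto simp: eventually_at)
    obtain d3 where d3: "0 < d3" "ball x d3 \<subseteq> S"
      using S by (meson open_contains_ball)
    define d where "d = min d1 (min d2 d3)"
    have d: "0 < d" "ball x d \<subseteq> S" using d1 d2 d3 by (auto simp: d_def)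
    define s where "s = d / (norm u + norm v + 1)"
    have n: "norm u + norm v + 1 > 0" by (simp add: add_nonneg_pos)
    have s: "0 < s" "s * (norm u + norm v) < d"
      using d n unfolding s_def by (auto simp: divide_simps)
    then have s': "s * (norm v + norm u) < d" by (simp add: add.commute)
    obtain z1 where z1: "z1 \<in> ball x d"
      "f (x + s *\<^sub>R u + s *\<^sub>R v) - f (x + s *\<^sub>R u) - f (x + s *\<^sub>R v) + f x = s\<^sup>2 * ?H z1 v u"
      using second_difference_eq_hessian[of x d f s u v] s f f' d by blast
    obtain z2 where z2: "z2 \<in> ball x d"
      "f (x + s *\<^sub>R v + s *\<^sub>R u) - f (x + s *\<^sub>R v) - f (x + s *\<^sub>R u) + f x = s\<^sup>2 * ?H z2 u v"
      using second_difference_eq_hessian[of x d f s v u] s s' f f' d by blast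
    have "s\<^sup>2 * ?H z1 v u = s\<^sup>2 * ?H z2 u v"
      using z1(2) z2(2) by (simp add: algebra_simps)
    then have eq: "?H z1 v u = ?H z2 u v" using s by simp
    have "dist (?H z1 v u) (?H x v u) < e/2"
      using d2(2)[of z1] z1(1) \<open>0 < e\<close> by (cases "z1 = x") (auto simp: d_def dist_commute)
    moreover have "dist (?H z2 u v) (?H x u v) < e/2"
      using d1(2)[of z2] z2(1) \<open>0 < e\<close> by (cases "z2 = x") (auto simp: d_def dist_commute)
    ultimately show ?thesis
      using eq unfolding dist_real_def by linarith
  qed
  show ?thesis
  proof (rule ccontr)
    assume "?H x u v \<noteq> ?H x v u"
    then have "0 < \<bar>?H x u v - ?H x v u\<bar>" by simp
    from close[OF this] show False by simp
  qed
qed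

text \<open>
  Differentiating a homogeneity relation once; it is applied both to \<open>F\<close> (where \<open>a = 1\<close> and \<open>k\<close>
  is the logarithmic term) and to its gradient.
\<close>
lemma fderiv_scale:
  fixes f :: "'a::real_normed_vector \<Rightarrow> 'b::real_normed_vector"
  assumes S: "open S" "x \<in> S"
    and f: "f differentiable (at x)" "f differentiable (at (\<tau> *\<^sub>R x))"
    and eq: "\<And>z. z \<in> S \<Longrightarrow> f (\<tau> *\<^sub>R z) = a *\<^sub>R f z + k"
  shows "\<tau> *\<^sub>R fderiv f (\<tau> *\<^sub>R x) = a *\<^sub>R fderiv f x"
proof -
  have 1: "((\<lambda>z. f (\<tau> *\<^sub>R z)) has_derivative (\<lambda>h. fderiv f (\<tau> *\<^sub>R x) (\<tau> *\<^sub>R h))) (at x)"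
    using diff_chain_at[of "\<lambda>z. \<tau> *\<^sub>R z" "\<lambda>h. \<tau> *\<^sub>R h" x, OF _ has_derivative_fderiv[OF f(2)]]
    by (simp add: o_def bounded_linear_imp_has_derivative bounded_linear_scaleR_right)
  have "((\<lambda>z. a *\<^sub>R f z + k) has_derivative (\<lambda>h. a *\<^sub>R fderiv f x h)) (at x)"
    using has_derivative_fderiv[OF f(1)] by (auto intro!: derivative_eq_intros)
  then have 2: "((\<lambda>z. f (\<tau> *\<^sub>R z)) has_derivative (\<lambda>h. a *\<^sub>R fderiv f x h)) (at x)"
    using has_derivative_transform_within_open[OF _ S, of "\<lambda>z. a *\<^sub>R f z + k"] eq by simp
  show ?thesis
    using fun_cong[OF has_derivative_unique[OF 1 2]]
    by (intro blinfun_eqI) (simp add: blinfun.scaleR_left blinfun.scaleR_right)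
qed


section \<open>Linear functionals on a Euclidean space\<close>

text \<open>
  The Riesz representative of a functional. It transports the duals of the spaces at hand to
  the spaces themselves, where invariance of domain, the inverse function theorem and orthogonal
  complements are stated.
\<close>
definition riesz :: "('a::euclidean_space \<Rightarrow>\<^sub>L real) \<Rightarrow> 'a"
  where "riesz s = (\<Sum>i\<in>Basis. s i *\<^sub>R i)"

lemma inner_riesz [simp]: "riesz s \<bullet> u = s u"
proof -
  have "s u = s (\<Sum>i\<in>Basis. (u \<bullet> i) *\<^sub>R i)" by (simp add: euclidean_representation)
  also have "\<dots> = (\<Sum>i\<in>Basis. (u \<bullet> i) * s i)"
    by (simp add: blinfun.sum_right blinfun.scaleR_right)
  also have "\<dots> = riesz s \<bullet> u"
    unfolding riesz_def inner_sum_left by (simp add: mult.commute inner_commute)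
  finally show ?thesis by simp
qed

lemma bounded_linear_riesz: "bounded_linear riesz"
  unfolding riesz_def
  by (intro bounded_linear_sum bounded_linear_scaleR_const blinfun.bounded_linear_left)

lemma blinfun_inner_right_riesz [simp]: "blinfun_inner_right (riesz s) = s"
  by (rule blinfun_eqI) simp

lemma riesz_blinfun_inner_right [simp]: "riesz (blinfun_inner_right v) = v"
  by (metis inner_riesz blinfun_inner_right.rep_eq vector_eq_rdot)

lemma norm_blinfun_inner_right_le: "norm (blinfun_inner_right v) \<le> norm v"
  by (rule norm_blinfun_bound) (auto simp: Cauchy_Schwarz_ineq2)

lemma adj_apply [simp]: "adj A y x = y \<bullet> A x"
  unfolding adj_def
  by (subst bounded_linear_Blinfun_apply)
    (auto intro: bounded_linear_compose[OF bounded_linear_inner_right blinfun.bounded_linear_right])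

lemma bounded_linear_adj: "bounded_linear (adj A)"
proof -
  have "linear (adj A)"
    by (rule linearI) (auto intro!: blinfun_eqI simp: blinfun.add_left blinfun.scaleR_left inner_add_left)
  then show ?thesis by (simp add: linear_conv_bounded_linear)
qed

text \<open>
  Lagrange multipliers exist: split the representative of \<open>s\<close> along the range of the adjoint.
  The orthogonal component lies in the kernel of \<open>A\<close>, so it is annihilated by \<open>s\<close> and must vanish.
\<close>
lemma functional_vanishing_on_kernel:
  fixes A :: "'a::euclidean_space \<Rightarrow>\<^sub>L (real ^ 'm)" and s :: "'a \<Rightarrow>\<^sub>L real"
  assumes "\<And>h. A h = 0 \<Longrightarrow> s h = 0"
  obtains y where "s = adj A y"
proof -
  let ?R = "range (\<lambda>y. riesz (adj A y))"
  have "linear (\<lambda>y. riesz (adj A y))"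
    using bounded_linear_compose[OF bounded_linear_riesz bounded_linear_adj]
    by (simp add: linear_conv_bounded_linear)
  then have "subspace ?R" by (simp add: linear_subspace_image)
  then have span: "span ?R = ?R" by (simp add: span_eq_iff)
  obtain u w where u: "u \<in> span ?R" and w: "\<And>z. z \<in> span ?R \<Longrightarrow> orthogonal w z"
    and uw: "riesz s = u + w"
    using orthogonal_subspace_decomp_exists[of ?R "riesz s"] by blast
  have "riesz (adj A y) \<bullet> w = 0" for y
    using w[of "riesz (adj A y)"] span by (auto simp: orthogonal_def inner_commute)
  then have "y \<bullet> A w = 0" for y by simp
  then have "A w = 0" using inner_eq_zero_iff by blast
  then have "riesz s \<bullet> w = 0" using assms by simp
  moreover have "u \<bullet> w = 0" using w[OF u] by (simp add: orthogonal_def inner_commute)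
  ultimately have "w = 0" using uw by (simp add: inner_add_left)
  then have "riesz s \<in> ?R" using uw u span by simp
  then obtain y where "riesz s = riesz (adj A y)" by blast
  then have "s = adj A y" by (metis blinfun_inner_right_riesz)
  then show ?thesis by (rule that)
qed

section \<open>Barriers of a cone\<close>

locale cone_barrier =
  fixes K :: "'a::euclidean_space set" and F :: "'a \<Rightarrow> real" and \<nu> :: real
  assumes proper: "proper_cone K" and barrier: "normal_barrier K \<nu> F"
begin

abbreviation "grad \<equiv> fderiv F"
abbreviation "hess \<equiv> fderiv (fderiv F)"

lemma nu_ge_1: "1 \<le> \<nu>"
  using barrier by (simp add: normal_barrier_def)

lemma barrier_scale: "x \<in> interior K \<Longrightarrow> 0 < \<tau> \<Longrightarrow> F (\<tau> *\<^sub>R x) = F x - \<nu> * ln \<tau>"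
  using barrier by (auto simp: normal_barrier_def)

lemma self_concordant_F: "self_concordant_on (interior K) F"
  using barrier by (simp add: normal_barrier_def)

lemma F_differentiable: "x \<in> interior K \<Longrightarrow> F differentiable (at x)"
  and grad_differentiable: "x \<in> interior K \<Longrightarrow> grad differentiable (at x)"
  and hess_differentiable: "x \<in> interior K \<Longrightarrow> hess differentiable (at x)"
  using self_concordant_F by (auto simp: self_concordant_on_def thrice_differentiable_on_def)

lemma third_derivative_le:
  "x \<in> interior K \<Longrightarrow> fderiv hess x h h h \<le> 2 * (hess x h h) powr (3/2)"
  using self_concordant_F by (auto simp: self_concordant_on_def)

lemma convex_F: "convex_on (interior K) F"
  and closed_epigraph: "closed (epigraph (interior K) F)"
  using self_concordant_F by (auto simp: self_concordant_on_def)

lemma closed_K: "closed K" and convex_K: "convex K" and cone_K: "cone K"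
  and pointed_K: "x \<in> K \<Longrightarrow> - x \<in> K \<Longrightarrow> x = 0"
  using proper by (auto simp: proper_cone_def)

lemma interior_scale:
  assumes "x \<in> interior K" "0 < \<tau>"
  shows "\<tau> *\<^sub>R x \<in> interior K"
proof -
  have "(\<lambda>x. \<tau> *\<^sub>R x) ` interior K \<subseteq> interior K"
  proof (rule interior_maximal)
    show "(\<lambda>x. \<tau> *\<^sub>R x) ` interior K \<subseteq> K"
      using cone_K \<open>0 < \<tau>\<close> interior_subset[of K] by (auto simp: cone_def less_imp_le subset_eq)
    show "open ((\<lambda>x. \<tau> *\<^sub>R x) ` interior K)"
      using \<open>0 < \<tau>\<close> by (intro open_scaling) auto
  qed
  then show ?thesis using assms by blast
qed

text \<open>
  At the origin homogeneity would force \<open>\<nu> ln \<tau> = 0\<close> for all \<open>\<tau>\<close>.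
\<close>
lemma zero_notin_interior: "0 \<notin> interior K"
proof
  assume "0 \<in> interior K"
  from barrier_scale[OF this, of 2] show False using nu_ge_1 by simp
qed

lemma segment_in_interior:
  assumes "x \<in> interior K" "y \<in> interior K" "0 \<le> s" "s \<le> 1"
  shows "x + s *\<^sub>R (y - x) \<in> interior K"
proof -
  have "(1 - s) *\<^sub>R x + s *\<^sub>R y \<in> interior K"
    using convexD_alt[OF convex_interior[OF convex_K]] assms by auto
  then show ?thesis by (simp add: algebra_simps)
qed

lemma F_above_tangent:
  assumes x: "x \<in> interior K" and y: "y \<in> interior K"
  shows "F x + grad x (y - x) \<le> F y"
proof -
  define \<phi> where "\<phi> s = F (x + s *\<^sub>R (y - x))" for s
  have "(\<phi> has_real_derivative grad x (y - x)) (at 0)"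
    using fderiv_along_line[of F x 0 "y - x"] F_differentiable[OF x] unfolding \<phi>_def by simp
  then have "((\<lambda>s. (\<phi> s - \<phi> 0) / s) \<longlongrightarrow> grad x (y - x)) (at_right 0)"
    unfolding has_field_derivative_iff by (auto intro: filterlim_mono[OF _ order_refl at_le])
  moreover have "\<forall>\<^sub>F s in at_right 0. (\<phi> s - \<phi> 0) / s \<le> F y - F x"
  proof (rule eventually_at_rightI[of 0 1])
    fix s :: real assume s: "s \<in> {0<..<1}"
    have "F ((1 - s) *\<^sub>R x + s *\<^sub>R y) \<le> (1 - s) * F x + s * F y"
      using convex_onD[OF convex_F] s x y by auto
    moreover have "(1 - s) *\<^sub>R x + s *\<^sub>R y = x + s *\<^sub>R (y - x)"
      by (simp add: algebra_simps)
    ultimately have "\<phi> s - \<phi> 0 \<le> s * (F y - F x)"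
      by (simp add: \<phi>_def algebra_simps)
    then show "(\<phi> s - \<phi> 0) / s \<le> F y - F x"
      using s by (simp add: divide_simps mult.commute)
  qed simp
  ultimately have "grad x (y - x) \<le> F y - F x"
    by (intro tendsto_upperbound) auto
  then show ?thesis by simp
qed

lemma eventually_line_in_interior:
  assumes "x \<in> interior K"
  shows "\<forall>\<^sub>F s in at (0::real). x + s *\<^sub>R h \<in> interior K"
proof -
  have "((\<lambda>s. x + s *\<^sub>R h) \<longlongrightarrow> x + 0 *\<^sub>R h) (at (0::real))"
    by (intro tendsto_intros)
  from topological_tendstoD[OF this open_interior] assms show ?thesis by simp
qed

lemma hess_nonneg:
  assumes x: "x \<in> interior K"
  shows "0 \<le> hess x h h"
proof -
  define \<phi> where "\<phi> s = grad (x + s *\<^sub>R h) h" for s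
  have "(\<phi> has_real_derivative hess x h h) (at 0)"
    using fderiv_along_line_apply[of grad x 0 h h] grad_differentiable[OF x] unfolding \<phi>_def
    by (simp add: has_real_derivative_iff_has_vector_derivative)
  then have "((\<lambda>s. (\<phi> s - \<phi> 0) / s) \<longlongrightarrow> hess x h h) (at_right 0)"
    unfolding has_field_derivative_iff by (auto intro: filterlim_mono[OF _ order_refl at_le])
  moreover have "\<forall>\<^sub>F s in at_right 0. 0 \<le> (\<phi> s - \<phi> 0) / s"
  proof -
    have "\<forall>\<^sub>F s in at_right (0::real). x + s *\<^sub>R h \<in> interior K"
      using filter_leD[OF at_le[OF subset_UNIV] eventually_line_in_interior[OF x]] .
    with eventually_at_right_less[of 0] show ?thesis
    proof eventually_elim
      case (elim s)
      have "grad (x + s *\<^sub>R h) (x - (x + s *\<^sub>R h)) + grad x ((x + s *\<^sub>R h) - x) \<le> 0"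
        using F_above_tangent[OF x elim(2)] F_above_tangent[OF elim(2) x] by linarith
      then have "s * \<phi> 0 \<le> s * \<phi> s"
        by (simp add: \<phi>_def blinfun.scaleR_right blinfun.minus_right)
      then show ?case using elim(1) by simp
    qed
  qed
  ultimately show ?thesis
    by (intro tendsto_lowerbound) auto
qed

lemma continuous_hess: "x \<in> interior K \<Longrightarrow> continuous (at x) hess"
  using hess_differentiable differentiable_imp_continuous_within by blast

lemma hess_symmetric:
  assumes "x \<in> interior K"
  shows "hess x u v = hess x v u"
  using assms F_differentiable grad_differentiable continuous_hess
  by (intro hessian_symmetric[of "interior K"]) auto

section \<open>Positive definiteness of the Hessian\<close>

text \<open>
  If the ray stayed in \<open>K\<close>, the points \<open>(x + s h) / s\<close> of \<open>K\<close> would converge to \<open>h\<close>.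
\<close>
lemma ray_leaves_interior:
  assumes x: "x \<in> interior K" and h: "h \<notin> K"
  obtains r where "0 < r" "x + r *\<^sub>R h \<notin> interior K"
    "\<And>s. 0 \<le> s \<Longrightarrow> s < r \<Longrightarrow> x + s *\<^sub>R h \<in> interior K"
proof -
  define T where "T = {s. 0 \<le> s \<and> x + s *\<^sub>R h \<notin> interior K}"
  have "\<exists>s>0. x + s *\<^sub>R h \<notin> K"
  proof (rule ccontr)
    assume "\<not> ?thesis"
    then have in_K: "x + s *\<^sub>R h \<in> K" if "0 < s" for s using that by auto
    have "inverse s *\<^sub>R (x + s *\<^sub>R h) \<in> K" if "0 < s" for s
      using in_K[OF that] cone_K that by (auto simp: cone_def)
    then have "inverse s *\<^sub>R x + h \<in> K" if "0 < s" for s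
      using that by (fastforce simp: scaleR_add_right)
    then have "\<forall>\<^sub>F s in at_top. inverse s *\<^sub>R x + h \<in> K"
      by (rule eventually_mono[OF eventually_gt_at_top[of 0]])
    moreover have "((\<lambda>s::real. inverse s *\<^sub>R x + h) \<longlongrightarrow> 0 *\<^sub>R x + h) at_top"
      by (intro tendsto_intros tendsto_inverse_0_at_top filterlim_ident)
    ultimately have "h \<in> K"
      using Lim_in_closed_set[OF closed_K, of "\<lambda>s::real. inverse s *\<^sub>R x + h" at_top] by simp
    with h show False ..
  qed
  then obtain s where "s > 0" "x + s *\<^sub>R h \<notin> K" by blast
  then have "s \<in> T"
    using interior_subset[of K] by (auto simp: T_def)
  then have "T \<noteq> {}" by blast
  moreover have "closed T"
  proof -
    have "T = {0..} \<inter> (\<lambda>s. x + s *\<^sub>R h) -` (- interior K)" by (auto simp: T_def)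
    moreover have "closed ((\<lambda>s. x + s *\<^sub>R h) -` (- interior K))"
      by (intro continuous_closed_vimage continuous_intros) auto
    ultimately show ?thesis by auto
  qed
  moreover have bdd: "bdd_below T" by (auto simp: T_def)
  ultimately have r: "Inf T \<in> T" by (intro closed_contains_Inf)
  show ?thesis
  proof
    show "x + Inf T *\<^sub>R h \<notin> interior K" using r by (simp add: T_def)
    then show "0 < Inf T" using r x by (cases "Inf T = 0") (auto simp: T_def)
    show "x + s *\<^sub>R h \<in> interior K" if "0 \<le> s" "s < Inf T" for s
      using cInf_lower[OF _ bdd, of s] that by (auto simp: T_def)
  qed
qed

text \<open>
  Suppose that \<open>F''(x) h h = 0\<close>. Along the ray from \<open>x\<close> in direction \<open>h\<close>, self-concordance bounds the
  derivative of \<open>\<phi> s = F''(x + s h) h h\<close> by \<open>2 \<phi>\<^sup>3\<^sup>/\<^sup>2\<close>, which on a compact piece is at most a constant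
  times \<open>\<phi>\<close>. Gronwall's argument keeps \<open>\<phi>\<close> at zero, so \<open>F\<close> is affine on the ray and stays
  bounded up to the point where the ray leaves the domain. The closed epigraph
  then puts this point into the domain.
\<close>
lemma hess_pos_outside_K:
  assumes x: "x \<in> interior K" and h: "h \<notin> K"
  shows "0 < hess x h h"
proof (rule ccontr)
  assume "\<not> ?thesis"
  with hess_nonneg[OF x, of h] have zero: "hess x h h = 0" by simp
  obtain r where r: "0 < r" "x + r *\<^sub>R h \<notin> interior K"
    and ins: "\<And>s. 0 \<le> s \<Longrightarrow> s < r \<Longrightarrow> x + s *\<^sub>R h \<in> interior K"
    using ray_leaves_interior[OF x h] by blast
  define \<phi> where "\<phi> s = hess (x + s *\<^sub>R h) h h" for s
  define \<phi>' where "\<phi>' s = fderiv hess (x + s *\<^sub>R h) h h h" for s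
  have d\<phi>: "(\<phi> has_real_derivative \<phi>' s) (at s)" if "0 \<le> s" "s < r" for s
    using bounded_linear.has_vector_derivative[OF blinfun.bounded_linear_left
        fderiv_along_line_apply[of hess x s h h, OF hess_differentiable[OF ins[OF that]]], of h]
    unfolding \<phi>_def \<phi>'_def has_real_derivative_iff_has_vector_derivative .
  have \<phi>0: "\<phi> s = 0" if s: "0 \<le> s" "s < r" for s
  proof -
    have "continuous_on {0..s} \<phi>"
      using d\<phi> s
      by (intro DERIV_atLeastAtMost_imp_continuous_on) (meson order.strict_trans1)
    then have "bdd_above (\<phi> ` {0..s})"
      by (intro compact_imp_bounded[THEN bounded_imp_bdd_above] compact_continuous_image) auto
    then obtain B where "\<forall>u\<in>{0..s}. \<phi> u \<le> B"
      by (auto simp: bdd_above_def)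
    then have B: "\<phi> u \<le> B" if "u \<in> {0..s}" for u using that by blast
    \<comment> \<open>With \<open>\<phi> \<le> B\<close>, the bound \<open>2 \<phi>\<^sup>3\<^sup>/\<^sup>2 = 2 \<phi> sqrt \<phi>\<close> becomes the linear bound \<open>2 N \<phi>\<close>.\<close>
    define N where "N = sqrt B"
    have le: "\<phi>' u \<le> 2 * N * \<phi> u" if "0 \<le> u" "u \<le> s" for u
    proof -
      have nn: "0 \<le> \<phi> u" unfolding \<phi>_def using ins that s by (intro hess_nonneg) auto
      have "\<phi>' u \<le> 2 * \<phi> u powr (3/2)"
        unfolding \<phi>_def \<phi>'_def using ins that s by (intro third_derivative_le) auto
      also have "\<phi> u powr (3/2) = \<phi> u * sqrt (\<phi> u)"
      proof (cases "\<phi> u = 0")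
        case False
        have "\<phi> u powr (3/2) = \<phi> u powr (1 + 1/2)" by simp
        also have "\<dots> = \<phi> u * sqrt (\<phi> u)"
          unfolding powr_add using nn False by (simp add: powr_half_sqrt)
        finally show ?thesis .
      qed simp
      also have "\<phi> u * sqrt (\<phi> u) \<le> \<phi> u * N"
        using B[of u] that nn by (intro mult_left_mono) (auto simp: N_def)
      finally show ?thesis by (simp add: mult_ac)
    qed
    have "\<phi> s * exp (- (2 * N * s)) \<le> \<phi> 0 * exp (- (2 * N * 0))"
    proof (rule DERIV_nonpos_imp_nonincreasing[OF s(1)])
      fix u assume u: "0 \<le> u" "u \<le> s"
      have "((\<lambda>u. \<phi> u * exp (- (2 * N * u))) has_real_derivative
          \<phi>' u * exp (- (2 * N * u)) + \<phi> u * (exp (- (2 * N * u)) * (- (2 * N)))) (at u)"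
        using u s by (auto intro!: derivative_eq_intros d\<phi>)
      moreover have "\<phi>' u * exp (- (2 * N * u)) + \<phi> u * (exp (- (2 * N * u)) * (- (2 * N)))
          = (\<phi>' u - 2 * N * \<phi> u) * exp (- (2 * N * u))"
        by (simp add: algebra_simps)
      moreover have "\<dots> \<le> 0" using le[OF u] by (simp add: mult_nonpos_nonneg)
      ultimately show "\<exists>y. ((\<lambda>u. \<phi> u * exp (- (2 * N * u))) has_real_derivative y) (at u) \<and> y \<le> 0"
        by metis
    qed
    then have "\<phi> s * exp (- (2 * N * s)) \<le> 0" using zero by (simp add: \<phi>_def)
    then have "\<phi> s \<le> 0" by (simp add: mult_le_0_iff)
    moreover have "0 \<le> \<phi> s" unfolding \<phi>_def using ins s by (intro hess_nonneg) auto
    ultimately show ?thesis by simp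
  qed
  have grad_const: "grad (x + s *\<^sub>R h) h = grad x h" if s: "0 < s" "s < r" for s
  proof -
    have "((\<lambda>s. grad (x + s *\<^sub>R h) h) has_real_derivative \<phi> u) (at u)" if "0 \<le> u" "u \<le> s" for u
      unfolding \<phi>_def has_real_derivative_iff_has_vector_derivative using that s
      by (intro fderiv_along_line_apply grad_differentiable ins) auto
    from MVT2[OF s(1) this] obtain u where "0 < u" "u < s"
      "grad (x + s *\<^sub>R h) h - grad (x + 0 *\<^sub>R h) h = (s - 0) * \<phi> u" by auto
    then show ?thesis using \<phi>0[of u] s by simp
  qed
  define B where "B = F x + r * \<bar>grad x h\<bar>"
  have below: "F (x + s *\<^sub>R h) \<le> B" if s: "0 < s" "s < r" for s
  proof -
    have "((\<lambda>s. F (x + s *\<^sub>R h)) has_real_derivative grad (x + u *\<^sub>R h) h) (at u)" if "0 \<le> u" "u \<le> s" for u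
      using that s by (intro fderiv_along_line F_differentiable ins) auto
    from MVT2[OF s(1) this] obtain u where "0 < u" "u < s"
      "F (x + s *\<^sub>R h) - F (x + 0 *\<^sub>R h) = (s - 0) * grad (x + u *\<^sub>R h) h" by auto
    then have "F (x + s *\<^sub>R h) = F x + s * grad x h" using grad_const[of u] s by simp
    also have "\<dots> \<le> F x + s * \<bar>grad x h\<bar>" using s by simp
    also have "\<dots> \<le> B" unfolding B_def using s by (intro add_mono mult_right_mono) auto
    finally show ?thesis .
  qed
  have lim: "((\<lambda>s. (x + s *\<^sub>R h, B)) \<longlongrightarrow> (x + r *\<^sub>R h, B)) (at_left r)"
    by (intro tendsto_intros)
  have "\<forall>\<^sub>F s in at_left r. (x + s *\<^sub>R h, B) \<in> epigraph (interior K) F"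
    using r(1) below ins by (intro eventually_at_leftI[of 0]) (auto simp: mem_epigraph)
  then have "(x + r *\<^sub>R h, B) \<in> epigraph (interior K) F"
    by (rule Lim_in_closed_set[OF closed_epigraph _ trivial_limit_at_left_real lim])
  with r(2) show False by (simp add: mem_epigraph)
qed

text \<open>
  One of \<open>h\<close> and \<open>- h\<close> lies outside the pointed cone, and the quadratic form does not
  distinguish them.
\<close>
lemma hess_pos:
  assumes x: "x \<in> interior K" and "h \<noteq> 0"
  shows "0 < hess x h h"
proof (cases "h \<in> K")
  case True
  then have "- h \<notin> K" using pointed_K \<open>h \<noteq> 0\<close> by auto
  from hess_pos_outside_K[OF x this] show ?thesis
    by (simp add: blinfun.minus_right blinfun.minus_left)
qed (rule hess_pos_outside_K[OF x])

section \<open>Logarithmic homogeneity\<close>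

lemma grad_scale:
  assumes "x \<in> interior K" "0 < \<tau>"
  shows "grad (\<tau> *\<^sub>R x) = inverse \<tau> *\<^sub>R grad x"
proof -
  have "\<tau> *\<^sub>R grad (\<tau> *\<^sub>R x) = 1 *\<^sub>R grad x"
    using assms F_differentiable interior_scale barrier_scale
    by (intro fderiv_scale[of "interior K" _ _ _ _ "- \<nu> * ln \<tau>"]) auto
  then have "inverse \<tau> *\<^sub>R (\<tau> *\<^sub>R grad (\<tau> *\<^sub>R x)) = inverse \<tau> *\<^sub>R grad x" by simp
  then show ?thesis using assms by simp
qed

lemma hess_scale:
  assumes "x \<in> interior K" "0 < \<tau>"
  shows "hess (\<tau> *\<^sub>R x) = inverse (\<tau>\<^sup>2) *\<^sub>R hess x"
proof -
  have "\<tau> *\<^sub>R hess (\<tau> *\<^sub>R x) = inverse \<tau> *\<^sub>R hess x"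
    using assms grad_differentiable interior_scale grad_scale
    by (intro fderiv_scale[of "interior K" _ _ _ _ 0]) auto
  then have "inverse \<tau> *\<^sub>R (\<tau> *\<^sub>R hess (\<tau> *\<^sub>R x)) = inverse \<tau> *\<^sub>R (inverse \<tau> *\<^sub>R hess x)" by simp
  then show ?thesis using assms by (simp add: power2_eq_square)
qed

text \<open>
  Differentiating \<open>F((1 + s) x) = F x - \<nu> ln (1 + s)\<close> at \<open>s = 0\<close>.
\<close>
lemma grad_self:
  assumes x: "x \<in> interior K"
  shows "grad x x = - \<nu>"
proof -
  have 1: "((\<lambda>s. F (x + s *\<^sub>R x)) has_real_derivative grad x x) (at 0)"
    using fderiv_along_line[of F x 0 x] F_differentiable[OF x] by simp
  have 2: "((\<lambda>s. F x - \<nu> * ln (1 + s)) has_real_derivative - \<nu>) (at 0)"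
    by (auto intro!: derivative_eq_intros)
  have "F x - \<nu> * ln (1 + s) = F (x + s *\<^sub>R x)" if "s \<in> {-1<..}" for s
    using barrier_scale[OF x, of "1 + s"] that by (simp add: scaleR_add_left)
  then have "((\<lambda>s. F (x + s *\<^sub>R x)) has_real_derivative - \<nu>) (at 0)"
    by (intro has_field_derivative_transform_within_open[OF 2, of "{-1<..}"]) auto
  with 1 show ?thesis by (rule DERIV_unique)
qed

text \<open>
  Differentiating \<open>F'((1 + s) x) = F'(x) / (1 + s)\<close> at \<open>s = 0\<close>.
\<close>
lemma hess_self:
  assumes x: "x \<in> interior K"
  shows "hess x x = - grad x"
proof (rule blinfun_eqI)
  fix u
  have 1: "((\<lambda>s. grad (x + s *\<^sub>R x) u) has_real_derivative hess x x u) (at 0)"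
    using fderiv_along_line_apply[of grad x 0 x u] grad_differentiable[OF x]
    by (simp add: has_real_derivative_iff_has_vector_derivative)
  have 2: "((\<lambda>s. inverse (1 + s) * grad x u) has_real_derivative - grad x u) (at 0)"
    by (auto intro!: derivative_eq_intros)
  have "inverse (1 + s) * grad x u = grad (x + s *\<^sub>R x) u" if "s \<in> {-1<..}" for s
    using grad_scale[OF x, of "1 + s"] that by (simp add: scaleR_add_left blinfun.scaleR_left)
  then have "((\<lambda>s. grad (x + s *\<^sub>R x) u) has_real_derivative - grad x u) (at 0)"
    by (intro has_field_derivative_transform_within_open[OF 2, of "{-1<..}"]) auto
  with 1 have "hess x x u = - grad x u" by (rule DERIV_unique)
  then show "hess x x u = (- grad x) u" by (simp add: blinfun.minus_left)
qed

text \<open>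
  Along a ray in the interior \<open>F\<close> decreases logarithmically, whereas a positive slope \<open>F'(x) z\<close>
  would make the tangent at \<open>x\<close> grow linearly. The boundary of \<open>K\<close> follows by density.
\<close>
lemma grad_nonpos:
  assumes x: "x \<in> interior K" and "y \<in> K"
  shows "grad x y \<le> 0"
proof -
  have int: "grad x z \<le> 0" if z: "z \<in> interior K" for z
  proof (rule ccontr)
    assume "\<not> ?thesis"
    then have pos: "0 < grad x z" by simp
    define C where "C = F z - F x - \<nu>"
    define \<tau> where "\<tau> = max 1 ((\<bar>C\<bar> + 1) / grad x z)"
    have \<tau>: "1 \<le> \<tau>" "(\<bar>C\<bar> + 1) / grad x z \<le> \<tau>" by (auto simp: \<tau>_def)
    have "F x + grad x (\<tau> *\<^sub>R z - x) \<le> F (\<tau> *\<^sub>R z)"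
      using \<tau> by (intro F_above_tangent x interior_scale z) auto
    also have "\<dots> = F z - \<nu> * ln \<tau>" using \<tau> z by (intro barrier_scale) auto
    also have "\<dots> \<le> F z" using \<tau> nu_ge_1 by simp
    finally have "\<tau> * grad x z \<le> C"
      using grad_self[OF x] by (simp add: C_def blinfun.diff_right blinfun.scaleR_right)
    moreover have "\<bar>C\<bar> + 1 \<le> \<tau> * grad x z" using \<tau>(2) pos by (simp add: divide_simps)
    ultimately show False by linarith
  qed
  have "closed {z. grad x z \<le> 0}"
    by (intro closed_Collect_le continuous_intros)
  moreover have "interior K \<subseteq> {z. grad x z \<le> 0}" using int by auto
  ultimately have "closure (interior K) \<subseteq> {z. grad x z \<le> 0}" by (simp add: closure_minimal)
  moreover have "closure (interior K) = K"
    using convex_closure_interior[OF convex_K] x closed_K by auto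
  ultimately show ?thesis using \<open>y \<in> K\<close> by auto
qed

section \<open>The dual barrier and its derivative\<close>

text \<open>
  Equal gradients at two points contradict the positive second derivative on the segment
  between them.
\<close>
lemma inj_on_grad: "inj_on grad (interior K)"
proof (rule inj_onI, rule ccontr)
  fix x y assume x: "x \<in> interior K" and y: "y \<in> interior K" and eq: "grad x = grad y" and "x \<noteq> y"
  have "((\<lambda>s. grad (x + s *\<^sub>R (y - x)) (y - x)) has_real_derivative
      hess (x + s *\<^sub>R (y - x)) (y - x) (y - x)) (at s)" if "0 \<le> s" "s \<le> 1" for s
    unfolding has_real_derivative_iff_has_vector_derivative
    using segment_in_interior[OF x y that]
    by (intro fderiv_along_line_apply grad_differentiable)
  from MVT2[OF zero_less_one this] obtain s where s: "0 < s" "s < 1"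
    "grad y (y - x) - grad x (y - x) = hess (x + s *\<^sub>R (y - x)) (y - x) (y - x)" by auto
  then show False
    using hess_pos[OF segment_in_interior[OF x y, of s], of "y - x"] eq \<open>x \<noteq> y\<close> by simp
qed

lemma continuous_on_riesz_grad: "continuous_on (interior K) (\<lambda>x. riesz (grad x))"
  using grad_differentiable differentiable_imp_continuous_within
  by (intro bounded_linear.continuous_on[OF bounded_linear_riesz] continuous_at_imp_continuous_on) blast

lemma inj_on_riesz_grad: "inj_on (\<lambda>x. riesz (grad x)) (interior K)"
  using inj_on_grad by (metis (mono_tags, lifting) blinfun_inner_right_riesz inj_on_def)

text \<open>
  Invariance of domain for the injective continuous gradient map. It provides the neighbourhoods
  in which the dual barrier is differentiated.
\<close>
lemma open_grad_image: "open {s. - s \<in> grad ` interior K}"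
proof -
  have "open ((\<lambda>x. riesz (grad x)) ` interior K)"
    by (intro invariance_of_domain continuous_on_riesz_grad inj_on_riesz_grad open_interior)
  moreover have "continuous_on UNIV (\<lambda>s::'a \<Rightarrow>\<^sub>L real. riesz (- s))"
    by (intro bounded_linear.continuous_on[OF bounded_linear_riesz] continuous_intros)
  ultimately have "open ((\<lambda>s. riesz (- s)) -` (\<lambda>x. riesz (grad x)) ` interior K)"
    by (rule open_vimage)
  moreover have "(\<lambda>s. riesz (- s)) -` (\<lambda>x. riesz (grad x)) ` interior K = {s. - s \<in> grad ` interior K}"
    by (auto simp: image_iff) (metis blinfun_inner_right_riesz)
  ultimately show ?thesis by simp
qed

text \<open>
  The set of all negated gradients is open and contained in the dual cone, hence in its interior.
\<close>
lemma neg_grad_in_interior_dual_cone: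
  assumes "x \<in> interior K"
  shows "- grad x \<in> interior (dual_cone K)"
proof -
  have "{s. - s \<in> grad ` interior K} \<subseteq> interior (dual_cone K)"
  proof (rule interior_maximal[OF _ open_grad_image])
    show "{s. - s \<in> grad ` interior K} \<subseteq> dual_cone K"
    proof (clarsimp simp: dual_cone_def)
      fix s x y assume "- s = grad x" "x \<in> interior K" "y \<in> K"
      then show "0 \<le> s y"
        using grad_nonpos[of x y] by (metis blinfun.minus_left neg_le_0_iff_le)
    qed
  qed
  then show ?thesis using assms by auto
qed

text \<open>
  The point at which the supremum defining the dual barrier at \<open>s\<close> is attained, that is, the
  solution of \<open>F'(x) = - s\<close>; it is meaningful for negated gradients only.
\<close>
definition conj_point :: "('a \<Rightarrow>\<^sub>L real) \<Rightarrow> 'a"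
  where "conj_point s = inv_into (interior K) grad (- s)"

lemma conj_point_neg_grad: "x \<in> interior K \<Longrightarrow> conj_point (- grad x) = x"
  by (simp add: conj_point_def inv_into_f_f[OF inj_on_grad])

lemma dual_barrier_neg_grad:
  assumes x: "x \<in> interior K"
  shows "dual_barrier K F (- grad x) = - \<nu> - F x"
  unfolding dual_barrier_def
proof (rule cSup_eq_maximum)
  show "- \<nu> - F x \<in> (\<lambda>z. - (- grad x) z - F z) ` interior K"
    using x grad_self[OF x] by (auto simp: blinfun.minus_left intro!: image_eqI[of _ _ x])
  show "v \<le> - \<nu> - F x" if v: "v \<in> (\<lambda>z. - (- grad x) z - F z) ` interior K" for v
  proof -
    from v obtain z where "z \<in> interior K" "v = - (- grad x) z - F z" by auto
    then show ?thesis using F_above_tangent[OF x, of z] grad_self[OF x]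
      by (simp add: blinfun.minus_left blinfun.diff_right)
  qed
qed

lemma hess_inverse:
  assumes x: "x \<in> interior K"
  obtains L where "bounded_linear L" "\<And>s. hess x (L s) = s"
proof -
  let ?f = "\<lambda>h. riesz (hess x h)"
  have lin: "linear ?f"
    using bounded_linear_compose[OF bounded_linear_riesz blinfun.bounded_linear_right]
    by (simp add: linear_conv_bounded_linear)
  have "inj ?f"
    unfolding linear_injective_0[OF lin]
  proof (intro allI impI, rule ccontr)
    fix h assume "?f h = 0" "h \<noteq> 0"
    then have "riesz (hess x h) \<bullet> h = 0" by simp
    with hess_pos[OF x \<open>h \<noteq> 0\<close>] show False by simp
  qed
  then obtain g where g: "linear g" "\<And>v. g (?f v) = v" "\<And>v. ?f (g v) = v"
    using linear_injective_isomorphism[OF lin] by blast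
  show ?thesis
  proof
    show "bounded_linear (\<lambda>s. g (riesz s))"
      using g(1) bounded_linear_compose[OF _ bounded_linear_riesz]
      by (simp add: linear_conv_bounded_linear)
    show "hess x (g (riesz s)) = s" for s
      using g(3)[of "riesz s"] by (metis blinfun_inner_right_riesz)
  qed
qed

text \<open>
  The inverse function theorem for the gradient map; the equation for \<open>L\<close> is the
  linearisation of \<open>F'(x) = - s\<close>.
\<close>
lemma conj_point_has_derivative:
  assumes x: "x \<in> interior K" and L: "bounded_linear L" "\<And>s. hess x (L s) = - s"
  shows "(conj_point has_derivative L) (at (- grad x))"
proof -
  let ?f = "\<lambda>x. riesz (grad x)" and ?g = "\<lambda>v. inv_into (interior K) grad (blinfun_inner_right v)"
  have f: "(?f has_derivative (\<lambda>h. riesz (hess x h))) (at x)"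
    using bounded_linear.has_derivative[OF bounded_linear_riesz
        has_derivative_fderiv[OF grad_differentiable[OF x]]] .
  have g: "(?g has_derivative (\<lambda>v. L (- blinfun_inner_right v))) (at (?f x))"
    by (rule has_derivative_inverse_strong[OF open_interior x continuous_on_riesz_grad _ f])
      (auto simp: inv_into_f_f[OF inj_on_grad] fun_eq_iff L)
  have "((\<lambda>s. riesz (- s)) has_derivative (\<lambda>s. riesz (- s))) (at (- grad x))"
    by (intro bounded_linear_imp_has_derivative bounded_linear_compose[OF bounded_linear_riesz]
        bounded_linear_minus bounded_linear_ident)
  from diff_chain_at[OF this, of ?g "\<lambda>v. L (- blinfun_inner_right v)"] g
  show ?thesis by (simp add: o_def conj_point_def[abs_def])
qed

text \<open>
  Near \<open>- F'(x)\<close> the dual barrier is \<open>- \<nu> - F\<close> at the solution of \<open>F'(z) = - s\<close>, so it inherits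
  differentiability from that solution. The chain rule produces \<open>- F'(x)\<close> applied to
  the inverse Hessian, which \<open>F'(x) = - F''(x) x\<close> and symmetry reduce to evaluation at \<open>x\<close>.
\<close>
lemma dual_barrier_has_derivative:
  assumes x: "x \<in> interior K"
  shows "(dual_barrier K F has_derivative (\<lambda>s. - s x)) (at (- grad x))"
proof -
  obtain L where L: "bounded_linear L" "\<And>s. hess x (L s) = s"
    using hess_inverse[OF x] by blast
  have cp: "(conj_point has_derivative (\<lambda>s. L (- s))) (at (- grad x))"
    by (rule conj_point_has_derivative[OF x])
      (auto simp: L intro!: bounded_linear_compose[OF L(1)] bounded_linear_minus bounded_linear_ident)
  have "(F has_derivative grad x) (at (conj_point (- grad x)))"
    using has_derivative_fderiv[OF F_differentiable[OF x]] by (simp add: conj_point_neg_grad[OF x])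
  from diff_chain_at[OF cp this]
  have "((\<lambda>s. - \<nu> - F (conj_point s)) has_derivative (\<lambda>s. - grad x (L (- s)))) (at (- grad x))"
    by (auto simp: o_def intro!: derivative_eq_intros)
  moreover have "- grad x (L (- s)) = - s x" for s
  proof -
    have "- grad x (L (- s)) = hess x x (L (- s))" by (simp add: hess_self[OF x] blinfun.minus_left)
    also have "\<dots> = hess x (L (- s)) x" by (rule hess_symmetric[OF x])
    finally show ?thesis by (simp add: L blinfun.minus_left)
  qed
  ultimately have "((\<lambda>s. - \<nu> - F (conj_point s)) has_derivative (\<lambda>s. - s x)) (at (- grad x))"
    by simp
  moreover have "- \<nu> - F (conj_point s) = dual_barrier K F s" if "s \<in> {s. - s \<in> grad ` interior K}" for s
  proof -
    from that obtain z where "z \<in> interior K" "- s = grad z" by auto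
    then show ?thesis using dual_barrier_neg_grad[of z] conj_point_neg_grad[of z]
      by (metis minus_minus)
  qed
  ultimately show ?thesis
    using has_derivative_transform_within_open[OF _ open_grad_image] x by force
qed

text \<open>
  A functional in the interior of the dual cone is at least \<open>\<delta> norm x\<close> on \<open>K\<close>, while homogeneity
  and the tangent bound on unit vectors let \<open>F\<close> decrease at most like \<open>- \<nu> ln (norm x)\<close>.
\<close>
lemma coercive:
  assumes s: "s \<in> interior (dual_cone K)" and t: "0 < t" and ne: "interior K \<noteq> {}"
  obtains k C where "0 < k" "\<And>x. x \<in> interior K \<Longrightarrow> k * norm x + C \<le> t * s x + F x"
proof -
  obtain e where e: "0 < e" "ball s e \<subseteq> dual_cone K"
    using s by (auto simp: mem_interior)
  define \<delta> where "\<delta> = e / 2"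
  have \<delta>: "0 < \<delta>" using e by (simp add: \<delta>_def)
  have s_ge: "\<delta> * norm x \<le> s x" if x: "x \<in> interior K" for x
  proof -
    define u where "u = x /\<^sub>R norm x"
    have "x \<noteq> 0" using zero_notin_interior x by auto
    then have "norm u = 1" by (simp add: u_def)
    have "norm (\<delta> *\<^sub>R blinfun_inner_right u) \<le> \<delta>"
      using norm_blinfun_inner_right_le[of u] \<delta> \<open>norm u = 1\<close> by simp
    then have "s - \<delta> *\<^sub>R blinfun_inner_right u \<in> ball s e"
      using e by (simp add: dist_norm \<delta>_def)
    then have "0 \<le> (s - \<delta> *\<^sub>R blinfun_inner_right u) x"
      using e(2) x interior_subset by (force simp: dual_cone_def)
    also have "\<dots> = s x - \<delta> * (u \<bullet> x)"
      by (simp add: blinfun.diff_left blinfun.scaleR_left)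
    also have "u \<bullet> x = norm x"
      using \<open>x \<noteq> 0\<close> by (simp add: u_def dot_square_norm power2_eq_square)
    finally show ?thesis by simp
  qed
  obtain z where z: "z \<in> interior K" using ne by auto
  define m where "m = F z - norm (grad z) * (1 + norm z)"
  \<comment> \<open>Chosen so that \<open>\<nu> ln r \<le> \<nu> (k r - ln k)\<close> uses up exactly half of the linear growth \<open>t \<delta> r\<close>.\<close>
  define k where "k = t * \<delta> / (2 * \<nu>)"
  have k: "0 < k" using t \<delta> nu_ge_1 by (simp add: k_def)
  show ?thesis
  proof
    show "0 < t * \<delta> / 2" using t \<delta> by simp
    fix x assume x: "x \<in> interior K"
    then have "x \<noteq> 0" using zero_notin_interior by auto
    define r where "r = norm x"
    have r: "0 < r" using \<open>x \<noteq> 0\<close> by (simp add: r_def)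
    define u where "u = x /\<^sub>R r"
    have u: "u \<in> interior K" "norm u = 1" "x = r *\<^sub>R u"
      using interior_scale[OF x, of "inverse r"] r by (auto simp: u_def r_def)
    have "\<bar>grad z (u - z)\<bar> \<le> norm (grad z) * norm (u - z)"
      using norm_blinfun[of "grad z" "u - z"] by simp
    also have "\<dots> \<le> norm (grad z) * (1 + norm z)"
      using norm_triangle_ineq4[of u z] u(2) by (intro mult_left_mono) auto
    finally have "m \<le> F u"
      using F_above_tangent[OF z u(1)] unfolding m_def by linarith
    moreover have "F x = F u - \<nu> * ln r"
      using barrier_scale[OF u(1) r] u(3) by simp
    moreover have "\<nu> * ln r \<le> \<nu> * (k * r - ln k)"
    proof (rule mult_left_mono)
      have "ln (k * r) \<le> k * r - 1" using k r by (intro ln_le_minus_one) auto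
      then show "ln r \<le> k * r - ln k" using k r by (simp add: ln_mult)
    qed (use nu_ge_1 in simp)
    moreover have "\<nu> * (k * r) = t * \<delta> / 2 * r" using nu_ge_1 by (simp add: k_def)
    moreover have "t * (\<delta> * r) \<le> t * s x"
      using s_ge[OF x] t by (simp add: r_def)
    ultimately show "t * \<delta> / 2 * norm x + (m + \<nu> * ln k) \<le> t * s x + F x"
      unfolding r_def[symmetric] right_diff_distrib by (simp add: mult.assoc)
  qed
qed

text \<open>
  Coercivity bounds the supremum, so that it is a genuine upper bound and not the arbitrary
  value of an unbounded one.
\<close>
lemma fenchel_young:
  assumes s: "s \<in> interior (dual_cone K)" and x: "x \<in> interior K"
  shows "- s x - F x \<le> dual_barrier K F s"
proof -
  obtain k C where "0 < k" and kC: "\<And>x. x \<in> interior K \<Longrightarrow> k * norm x + C \<le> 1 * s x + F x"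
    using coercive[OF s zero_less_one] x by blast
  have "- s z - F z \<le> - C" if z: "z \<in> interior K" for z
  proof -
    have "0 \<le> k * norm z" using \<open>0 < k\<close> by simp
    with kC[OF z] show ?thesis by linarith
  qed
  then have "bdd_above ((\<lambda>z. - s z - F z) ` interior K)"
    by (auto simp: bdd_above_def)
  then show ?thesis unfolding dual_barrier_def using x by (intro cSUP_upper)
qed

text \<open>
  In the case of equality \<open>x\<close> maximises a differentiable function over an open set.
\<close>
lemma fenchel_young_eq_imp:
  assumes s: "s \<in> interior (dual_cone K)" and x: "x \<in> interior K"
    and eq: "- s x - F x = dual_barrier K F s"
  shows "s = - grad x"
proof -
  have "((\<lambda>z. - s z - F z) has_derivative (\<lambda>h. - s h - grad x h)) (at x)"
    by (intro has_derivative_diff has_derivative_minus has_derivative_fderiv F_differentiable x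
        bounded_linear_imp_has_derivative blinfun.bounded_linear_right)
  moreover have "- s z - F z \<le> - s x - F x" if "z \<in> interior K" for z
    using fenchel_young[OF s that] eq by simp
  ultimately have "(\<lambda>h. - s h - grad x h) = (\<lambda>h. 0)"
    using differential_zero_maxmin[OF x open_interior] by blast
  then have "- s h = grad x h" for h by (metis eq_iff_diff_eq_0)
  then show ?thesis by (intro blinfun_eqI) (metis blinfun.minus_left minus_minus)
qed

section \<open>The two Newton decrements\<close>

lemma hess_cauchy_schwarz:
  assumes x: "x \<in> interior K"
  shows "(hess x q h)\<^sup>2 \<le> hess x q q * hess x h h"
proof (cases "h = 0")
  case False
  define a where "a = hess x h h"
  define r where "r = hess x q h / a"
  have a: "0 < a" using hess_pos[OF x False] by (simp add: a_def)
  have "0 \<le> hess x (q - r *\<^sub>R h) (q - r *\<^sub>R h)" by (rule hess_nonneg[OF x])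
  also have "\<dots> = hess x q q - 2 * r * hess x q h + r\<^sup>2 * a"
    using hess_symmetric[OF x, of h q] unfolding a_def
    by (simp add: blinfun.diff_left blinfun.diff_right blinfun.scaleR_left blinfun.scaleR_right
        power2_eq_square algebra_simps)
  also have "\<dots> = hess x q q - (hess x q h)\<^sup>2 / a"
    using a by (simp add: r_def power2_eq_square field_simps)
  finally show ?thesis using a by (simp add: a_def field_simps)
qed simp

text \<open>
  The dual norm of the functional \<open>- F''(x) q\<close> on the kernel of \<open>A\<close> is the local norm of its
  representative \<open>q\<close>: an upper bound by Cauchy-Schwarz, attained in the direction \<open>- q\<close>.
\<close>
lemma lambda_g_eq:
  fixes A :: "'a \<Rightarrow>\<^sub>L (real ^ 'm)"
  assumes x: "x \<in> interior K" and q: "A q = 0"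
    and grad: "\<And>h. A h = 0 \<Longrightarrow> grad x h = - hess x q h"
  shows "(lambda_g F A x)\<^sup>2 = hess x q q"
proof -
  define b where "b = sqrt (hess x q q)"
  have b2: "b\<^sup>2 = hess x q q" and b0: "0 \<le> b"
    using hess_nonneg[OF x] by (auto simp: b_def)
  have "lambda_g F A x = b"
    unfolding lambda_g_def
  proof (rule cSup_eq_maximum)
    \<comment> \<open>For \<open>b = 0\<close> this is \<open>0\<close>, which attains the value \<open>0\<close> as required.\<close>
    define h where "h = - inverse b *\<^sub>R q"
    have "A h = 0" using q by (simp add: h_def blinfun.minus_right blinfun.scaleR_right)
    moreover have "hess x h h = inverse b * inverse b * b\<^sup>2"
      by (simp add: h_def b2 blinfun.minus_right blinfun.scaleR_right blinfun.minus_left blinfun.scaleR_left)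
    then have "hess x h h \<le> 1" by (cases "b = 0") (simp_all add: power2_eq_square field_simps)
    moreover have "grad x h = b"
    proof -
      have "grad x h = - hess x q h" using grad \<open>A h = 0\<close> .
      also have "\<dots> = inverse b * b\<^sup>2"
        by (simp add: h_def b2 blinfun.minus_right blinfun.scaleR_right)
      finally show ?thesis by (cases "b = 0") (simp_all add: power2_eq_square)
    qed
    ultimately show "b \<in> {grad x h |h. A h = 0 \<and> hess x h h \<le> 1}" by force
  next
    fix v assume "v \<in> {grad x h |h. A h = 0 \<and> hess x h h \<le> 1}"
    then obtain h where h: "v = grad x h" "A h = 0" "hess x h h \<le> 1" by auto
    have "v\<^sup>2 = (hess x q h)\<^sup>2" using h grad by simp
    also have "\<dots> \<le> hess x q q * hess x h h" by (rule hess_cauchy_schwarz[OF x])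
    also have "\<dots> \<le> b\<^sup>2" using h(3) hess_nonneg[OF x, of q] b2 by (simp add: mult_left_le)
    finally show "v \<le> b" using b0 by (rule power2_le_imp_le)
  qed
  then show ?thesis using b2 by simp
qed

text \<open>
  Pythagoras for \<open>x = p + q\<close>, where \<open>F''(x) p\<close> vanishes on the kernel of \<open>A\<close> and thus on \<open>q\<close>.
\<close>
lemma decrement_decomposition:
  fixes A :: "'a \<Rightarrow>\<^sub>L (real ^ 'm)"
  assumes x: "x \<in> interior K" and p: "A p = A x" "hess x p = adj A z"
  shows "(lambda_g F A x)\<^sup>2 + hess x p p = \<nu>"
proof -
  define q where "q = x - p"
  have Aq: "A q = 0" using p by (simp add: q_def blinfun.diff_right)
  have pq: "hess x p q = 0" using p(2) Aq by simp
  then have qp: "hess x q p = 0" using hess_symmetric[OF x] by simp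
  have "(lambda_g F A x)\<^sup>2 = hess x q q"
  proof (rule lambda_g_eq[where A = A, OF x Aq])
    fix h assume "A h = 0"
    then have "hess x p h = 0" using p(2) by simp
    moreover have "grad x h = - hess x x h" by (simp add: hess_self[OF x] blinfun.minus_left)
    ultimately show "grad x h = - hess x q h" by (simp add: q_def blinfun.diff_right blinfun.diff_left)
  qed
  moreover have "\<nu> = hess x x x"
    by (simp add: hess_self[OF x] grad_self[OF x] blinfun.minus_left)
  moreover have "hess x x x = hess x (p + q) (p + q)" by (simp add: q_def)
  then have "hess x x x = hess x p p + hess x q q"
    using pq qp by (simp add: blinfun.add_left blinfun.add_right)
  ultimately show ?thesis by simp
qed

text \<open>
  By the chain rule \<open>\<zeta>\<close> has gradient \<open>k \<mapsto> k \<bullet> A v\<close> at \<open>w\<close>, where \<open>v\<close> solves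
  \<open>F'(v) = A\<^sup>* w - c\<close>. At \<open>y\<close> this gives the gradient \<open>A x\<close> and the Hessian \<open>A F''(x)\<^sup>-\<^sup>1 A\<^sup>*\<close>, which is injective
  together with \<open>A\<^sup>*\<close> and hence invertible. The Newton step \<open>z\<close> defines \<open>p = F''(x)\<^sup>-\<^sup>1 A\<^sup>* z\<close>, and the
  squared decrement \<open>A x \<bullet> z = A p \<bullet> z\<close> is the squared length of \<open>p\<close>.
\<close>
lemma lambda_zeta_eq:
  fixes A :: "'a \<Rightarrow>\<^sub>L (real ^ 'm)" and c :: "'a \<Rightarrow>\<^sub>L real"
  assumes x: "x \<in> interior K" and inj: "inj (adj A)" and y: "c - adj A y = - grad x"
  obtains p z where "A p = A x" "hess x p = adj A z" "(lambda_zeta K F A c y)\<^sup>2 = hess x p p"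
proof -
  let ?z = "zeta K F A c"
  define U where "U = {s. - s \<in> grad ` interior K}"
  define V where "V = {w. c - adj A w \<in> U}"
  have cont: "continuous_on UNIV (\<lambda>w. c - adj A w)"
    by (intro continuous_intros bounded_linear.continuous_on[OF bounded_linear_adj])
  have "open V"
    using open_vimage[OF open_grad_image cont] by (simp add: V_def U_def vimage_def)
  have "y \<in> V" unfolding V_def U_def mem_Collect_eq y using x by simp
  have daff: "((\<lambda>w. c - adj A w) has_derivative (\<lambda>k. - adj A k)) (at w)" for w
    using bounded_linear_imp_has_derivative[OF bounded_linear_adj, of A "at w"]
    by (auto intro!: derivative_eq_intros)
  have fz: "fderiv ?z w = blinfun_inner_right (A (conj_point (c - adj A w)))" if w: "w \<in> V" for w
  proof -
    obtain v where v: "v \<in> interior K" "- (c - adj A w) = grad v"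
      using w unfolding V_def U_def by blast
    from arg_cong[OF v(2), of uminus] have v': "c - adj A w = - grad v" by simp
    have "(dual_barrier K F has_derivative (\<lambda>s. - s v)) (at (c - adj A w))"
      using dual_barrier_has_derivative[OF v(1)] v' by simp
    from diff_chain_at[OF daff this]
    have "(?z has_derivative (\<lambda>k. adj A k v)) (at w)"
      by (simp add: o_def zeta_def[abs_def] blinfun.minus_left)
    moreover have "(\<lambda>k. adj A k v) = blinfun_inner_right (A (conj_point (c - adj A w)))"
      using v' conj_point_neg_grad[OF v(1)] by (auto simp: inner_commute)
    ultimately show ?thesis by (intro fderiv_eqI) simp
  qed
  obtain L where L: "bounded_linear L" "\<And>s. hess x (L s) = s"
    using hess_inverse[OF x] by blast
  define M where "M k = L (adj A k)" for k
  have M: "bounded_linear M" "\<And>k. hess x (M k) = adj A k"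
    unfolding M_def using L bounded_linear_compose[OF L(1) bounded_linear_adj] by auto
  have AM: "bounded_linear (\<lambda>k. A (M k))"
    by (rule bounded_linear_compose[OF blinfun.bounded_linear_right M(1)])
  have "bounded_linear (\<lambda>s. L (- s))"
    by (intro bounded_linear_compose[OF L(1)] bounded_linear_minus bounded_linear_ident)
  then have "(conj_point has_derivative (\<lambda>s. L (- s))) (at (c - adj A y))"
    unfolding y using conj_point_has_derivative[OF x] L by simp
  from diff_chain_at[OF daff this]
  have "((\<lambda>w. conj_point (c - adj A w)) has_derivative M) (at y)"
    by (simp add: o_def M_def[abs_def])
  then have dG: "((\<lambda>w. blinfun_inner_right (A (conj_point (c - adj A w)))) has_derivative
      (\<lambda>k. blinfun_inner_right (A (M k)))) (at y)"
    by (intro bounded_linear.has_derivative[OF bounded_linear_blinfun_inner_right]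
        bounded_linear.has_derivative[OF blinfun.bounded_linear_right])
  define HZ where "HZ = Blinfun (\<lambda>k. blinfun_inner_right (A (M k)))"
  have HZ: "blinfun_apply HZ = (\<lambda>k. blinfun_inner_right (A (M k)))"
    unfolding HZ_def by (rule bounded_linear_Blinfun_apply)
      (rule bounded_linear_compose[OF bounded_linear_blinfun_inner_right AM])
  have "(fderiv ?z has_derivative blinfun_apply HZ) (at y)"
    using has_derivative_transform_within_open[OF dG \<open>open V\<close> \<open>y \<in> V\<close>] fz HZ by simp
  then have ffz: "fderiv (fderiv ?z) y = HZ" by (rule fderiv_eqI)
  have inj_AM: "inj (\<lambda>k. A (M k))"
    unfolding linear_injective_0[OF AM[unfolded linear_conv_bounded_linear[symmetric]]]
  proof (intro allI impI)
    fix k assume "A (M k) = 0"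
    then have "hess x (M k) (M k) = 0" using M(2) by simp
    then have "M k = 0" using hess_pos[OF x, of "M k"] by fastforce
    then have "adj A k = adj A 0" using M(2)[of k] bounded_linear_adj[of A]
      by (simp add: linear_simps)
    then show "k = 0" using inj by (simp add: inj_eq)
  qed
  then have "surj (\<lambda>k. A (M k))"
    using AM linear_injective_imp_surjective linear_conv_bounded_linear by blast
  then obtain z where z: "A (M z) = A x" by (metis surjD)
  define p where "p = M z"
  have hp: "hess x p = adj A z" using M(2) by (simp add: p_def)
  have fy: "fderiv ?z y = blinfun_inner_right (A x)"
    using fz[OF \<open>y \<in> V\<close>] y conj_point_neg_grad[OF x] by simp
  have "inj HZ"
  proof (rule injI)
    fix u v assume "HZ u = HZ v"
    then have "riesz (HZ u) = riesz (HZ v)" by simp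
    then have "A (M u) = A (M v)" by (simp add: HZ)
    then show "u = v" by (rule injD[OF inj_AM])
  qed
  then have inv: "inv HZ (fderiv ?z y) = z"
    by (rule inv_f_eq) (simp add: fy HZ z)
  have "fderiv ?z y (inv HZ (fderiv ?z y)) = A x \<bullet> z"
    unfolding inv by (simp add: fy)
  also have "\<dots> = hess x p p"
    using hp z by (simp add: p_def inner_commute)
  finally have "lambda_zeta K F A c y = sqrt (hess x p p)"
    by (simp add: lambda_zeta_def Let_def ffz)
  then have "(lambda_zeta K F A c y)\<^sup>2 = hess x p p"
    using hess_nonneg[OF x] by simp
  with z hp show ?thesis by (intro that) (auto simp: p_def)
qed

text \<open>
  Passing to \<open>t x\<close> divides the gradient by \<open>t\<close> and the Hessian by \<open>t\<^sup>2\<close>, which rescaling \<open>h\<close> undoes.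
\<close>
lemma lambda_g_scale:
  fixes A :: "'a \<Rightarrow>\<^sub>L (real ^ 'm)"
  assumes x: "x \<in> interior K" and t: "0 < t"
  shows "lambda_g F A (t *\<^sub>R x) = lambda_g F A x"
proof -
  have "{grad (t *\<^sub>R x) h |h. A h = 0 \<and> hess (t *\<^sub>R x) h h \<le> 1}
      = {grad x h |h. A h = 0 \<and> hess x h h \<le> 1}" (is "?L = ?R")
  proof (intro equalityI subsetI)
    fix v assume "v \<in> ?L"
    then obtain h where h: "v = grad (t *\<^sub>R x) h" "A h = 0" "hess (t *\<^sub>R x) h h \<le> 1" by auto
    show "v \<in> ?R"
      using h t unfolding mem_Collect_eq grad_scale[OF x t] hess_scale[OF x t]
      by (intro exI[of _ "inverse t *\<^sub>R h"])
        (simp add: blinfun.scaleR_left blinfun.scaleR_right power2_eq_square mult.assoc)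
  next
    fix v assume "v \<in> ?R"
    then obtain h where h: "v = grad x h" "A h = 0" "hess x h h \<le> 1" by auto
    show "v \<in> ?L"
      using h t unfolding mem_Collect_eq grad_scale[OF x t] hess_scale[OF x t]
      by (intro exI[of _ "t *\<^sub>R h"])
        (simp add: blinfun.scaleR_left blinfun.scaleR_right power2_eq_square field_simps)
  qed
  then show ?thesis by (simp add: lambda_g_def)
qed

section \<open>The central paths\<close>

text \<open>
  On \<open>A z = b\<close> the functionals \<open>c\<close> and \<open>s0\<close> differ by a constant, so a strictly feasible \<open>s0\<close>
  makes the objective coercive; closedness of the sublevel sets comes from the closed epigraph.
\<close>
lemma primal_path_minimizes:
  fixes A :: "'a \<Rightarrow>\<^sub>L (real ^ 'm)" and c :: "'a \<Rightarrow>\<^sub>L real"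
  assumes primal: "x0 \<in> interior K" "A x0 = b"
    and dual: "s0 \<in> interior (dual_cone K)" "s0 + adj A y0 = c" and t: "0 < t"
  defines "x \<equiv> primal_path K F A b c t"
  shows "x \<in> interior K" "A x = b"
    "\<And>z. z \<in> interior K \<Longrightarrow> A z = b \<Longrightarrow> t * c x + F x \<le> t * c z + F z"
proof -
  define f where "f z = t * c z + F z" for z
  define Q where "Q = {z \<in> interior K. f z \<le> f x0 \<and> A z = b}"
  have c_eq: "c z = s0 z + y0 \<bullet> A z" for z
    using arg_cong[OF dual(2), of "\<lambda>s. s z"] by (simp add: blinfun.add_left)
  have "x0 \<in> Q" using primal by (simp add: Q_def)
  have "closed Q"
  proof -
    have "closed ((\<lambda>z. (z, f x0 - t * c z)) -` epigraph (interior K) F)"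
      by (intro continuous_closed_vimage closed_epigraph continuous_intros)
    moreover have "closed {z. A z = b}" by (intro closed_Collect_eq continuous_intros)
    moreover have "Q = (\<lambda>z. (z, f x0 - t * c z)) -` epigraph (interior K) F \<inter> {z. A z = b}"
      by (auto simp: Q_def f_def mem_epigraph)
    ultimately show ?thesis by auto
  qed
  moreover have "bounded Q"
  proof -
    obtain k C where k: "0 < k" and kC: "\<And>x. x \<in> interior K \<Longrightarrow> k * norm x + C \<le> t * s0 x + F x"
      using coercive[OF dual(1) t] primal by blast
    have "norm z \<le> (f x0 - C - t * (y0 \<bullet> b)) / k" if "z \<in> Q" for z
    proof -
      have "z \<in> interior K" "f z \<le> f x0" "A z = b" using that by (auto simp: Q_def)
      then have "k * norm z \<le> f x0 - C - t * (y0 \<bullet> b)"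
        using kC[of z] c_eq[of z] by (simp add: f_def distrib_left)
      then show ?thesis using k by (simp add: pos_le_divide_eq mult.commute)
    qed
    then show ?thesis by (auto simp: bounded_iff)
  qed
  ultimately have "compact Q" by (simp add: compact_eq_bounded_closed)
  moreover have "continuous_on Q f"
  proof -
    have "continuous_on Q F"
      using F_differentiable differentiable_imp_continuous_within
      by (intro continuous_at_imp_continuous_on) (auto simp: Q_def)
    then show ?thesis unfolding f_def by (intro continuous_intros)
  qed
  ultimately obtain m where m: "m \<in> Q" "\<And>z. z \<in> Q \<Longrightarrow> f m \<le> f z"
    using continuous_attains_inf[of Q f] \<open>x0 \<in> Q\<close> by blast
  have "is_arg_min f (\<lambda>x. x \<in> interior K \<and> A x = b) m"
    unfolding is_arg_min_linorder
  proof (intro conjI allI impI)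
    show "m \<in> interior K" "A m = b" using m(1) by (auto simp: Q_def)
    fix z assume "z \<in> interior K \<and> A z = b"
    then show "f m \<le> f z"
      using m(2)[of z] m(1) by (cases "f z \<le> f x0") (auto simp: Q_def)
  qed
  then have "is_arg_min f (\<lambda>x. x \<in> interior K \<and> A x = b) x"
    unfolding x_def primal_path_def arg_min_def f_def[symmetric] by (rule someI)
  then show "x \<in> interior K" "A x = b"
    "\<And>z. z \<in> interior K \<Longrightarrow> A z = b \<Longrightarrow> t * c x + F x \<le> t * c z + F z"
    unfolding is_arg_min_linorder f_def by auto
qed

text \<open>
  The derivative of the objective vanishes on the kernel of \<open>A\<close>, so it comes from a Lagrange
  multiplier, which divided by \<open>t\<close> is the dual point.
\<close>
lemma primal_path_stationary:
  fixes A :: "'a \<Rightarrow>\<^sub>L (real ^ 'm)" and c :: "'a \<Rightarrow>\<^sub>L real"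
  assumes x: "x \<in> interior K" "A x = b" and t: "0 < t"
    and min: "\<And>z. z \<in> interior K \<Longrightarrow> A z = b \<Longrightarrow> t * c x + F x \<le> t * c z + F z"
  obtains y where "c - adj A y = - grad (t *\<^sub>R x)"
proof -
  have "(t *\<^sub>R c + grad x) h = 0" if h: "A h = 0" for h
  proof -
    have deriv: "((\<lambda>s. t * c (x + s *\<^sub>R h) + F (x + s *\<^sub>R h)) has_real_derivative (t * c h + grad x h)) (at 0)"
    proof (rule DERIV_add)
      have "((\<lambda>s. t * (c x + s * c h)) has_real_derivative t * c h) (at 0)"
        by (auto intro!: derivative_eq_intros)
      then show "((\<lambda>s. t * c (x + s *\<^sub>R h)) has_real_derivative t * c h) (at 0)"
        by (simp add: blinfun.add_right blinfun.scaleR_right)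
      show "((\<lambda>s. F (x + s *\<^sub>R h)) has_real_derivative grad x h) (at 0)"
        using fderiv_along_line[of F x 0 h] F_differentiable[OF x(1)] by simp
    qed
    obtain d where d0: "0 < d" and d: "\<And>s. s \<noteq> 0 \<Longrightarrow> dist s 0 < d \<Longrightarrow> x + s *\<^sub>R h \<in> interior K"
      using eventually_line_in_interior[OF x(1), of h] by (auto simp: eventually_at)
    have "\<forall>s. \<bar>0 - s\<bar> < d \<longrightarrow>
        t * c (x + 0 *\<^sub>R h) + F (x + 0 *\<^sub>R h) \<le> t * c (x + s *\<^sub>R h) + F (x + s *\<^sub>R h)"
    proof (intro allI impI)
      fix s assume "\<bar>0 - s\<bar> < d"
      then have "x + s *\<^sub>R h \<in> interior K" using d[of s] x by (cases "s = 0") auto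
      moreover have "A (x + s *\<^sub>R h) = b" using x h by (simp add: blinfun.add_right blinfun.scaleR_right)
      ultimately show "t * c (x + 0 *\<^sub>R h) + F (x + 0 *\<^sub>R h) \<le> t * c (x + s *\<^sub>R h) + F (x + s *\<^sub>R h)"
        using min by simp
    qed
    with deriv d0 have "t * c h + grad x h = 0" by (rule DERIV_local_min)
    then show ?thesis by (simp add: blinfun.add_left blinfun.scaleR_left)
  qed
  from functional_vanishing_on_kernel[OF this] obtain y where y: "t *\<^sub>R c + grad x = adj A y" .
  have "adj A (inverse t *\<^sub>R y) = inverse t *\<^sub>R adj A y"
    using bounded_linear_adj[of A] by (simp add: linear_simps)
  also have "\<dots> = c + inverse t *\<^sub>R grad x"
    unfolding y[symmetric] using t by (simp add: scaleR_add_right)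
  finally have "c - adj A (inverse t *\<^sub>R y) = - grad (t *\<^sub>R x)"
    using grad_scale[OF x(1) t] by simp
  then show ?thesis by (rule that)
qed

text \<open>
  Weak duality at \<open>t x\<close>: the dual objective of every feasible \<open>(w, s)\<close> is at most
  \<open>t \<langle>c, x\<rangle> + F(t x)\<close>, by the Fenchel-Young inequality. The point \<open>- F'(t x)\<close> attains this bound, so
  each maximiser attains it too, and equality in Fenchel-Young identifies its slack with
  \<open>- F'(t x)\<close>.
\<close>
lemma dual_path_eq:
  fixes A :: "'a \<Rightarrow>\<^sub>L (real ^ 'm)" and c :: "'a \<Rightarrow>\<^sub>L real"
  assumes x: "x \<in> interior K" "A x = b" and t: "0 < t"
    and y: "c - adj A y = - grad (t *\<^sub>R x)"
  shows "c - adj A (fst (dual_path K F A b c t)) = - grad (t *\<^sub>R x)"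
proof -
  define P where "P = (\<lambda>(y, s). s \<in> interior (dual_cone K) \<and> s + adj A y = c)"
  define f where "f = (\<lambda>(y, s). t * (b \<bullet> y) - dual_barrier K F s)"
  have tx: "t *\<^sub>R x \<in> interior K" using interior_scale[OF x(1) t] .
  have value_eq: "t * (b \<bullet> w) = t * c x + - s (t *\<^sub>R x)" if "s + adj A w = c" for w s
  proof -
    have "c x = s x + b \<bullet> w"
      unfolding that[symmetric] using x(2) by (simp add: blinfun.add_left inner_commute)
    then show ?thesis by (simp add: blinfun.scaleR_right distrib_left)
  qed
  define p where "p = (y, - grad (t *\<^sub>R x))"
  have "- grad (t *\<^sub>R x) + adj A y = c" unfolding y[symmetric] by simp
  then have Pp: "P p" using neg_grad_in_interior_dual_cone[OF tx] by (simp add: P_def p_def)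
  have fp: "f p = t * c x + F (t *\<^sub>R x)"
    using value_eq[of "- grad (t *\<^sub>R x)" y] Pp dual_barrier_neg_grad[OF tx] grad_self[OF tx]
    by (simp add: f_def p_def P_def blinfun.minus_left)
  have le: "f r \<le> t * c x + F (t *\<^sub>R x)" if "P r" for r
    using that value_eq[of "snd r" "fst r"] fenchel_young[OF _ tx, of "snd r"]
    by (auto simp: f_def P_def split: prod.splits)
  define r where "r = dual_path K F A b c t"
  have "is_arg_max f P p" using Pp fp le unfolding is_arg_max_linorder by metis
  then have "is_arg_max f P r"
    unfolding r_def dual_path_def arg_max_def P_def[symmetric] f_def[symmetric] by (rule someI)
  then have Pr: "P r" and "f p \<le> f r" using Pp unfolding is_arg_max_linorder by blast+
  then have fr: "f r = t * c x + F (t *\<^sub>R x)" using le[OF Pr] fp by linarith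
  obtain w s where ws: "r = (w, s)" by (cases r)
  have s: "s \<in> interior (dual_cone K)" "s + adj A w = c" using Pr by (auto simp: P_def ws)
  have "- s (t *\<^sub>R x) - F (t *\<^sub>R x) = dual_barrier K F s"
    using fr value_eq[OF s(2)] by (simp add: f_def ws)
  from fenchel_young_eq_imp[OF s(1) tx this] s(2) show ?thesis
    unfolding r_def[symmetric] ws by (simp add: algebra_simps)
qed

end

section \<open>The identity on the central paths\<close>

theorem lemma4:
  fixes K :: "'a::euclidean_space set" and F :: "'a \<Rightarrow> real" and \<nu> t :: real
    and A :: "'a \<Rightarrow>\<^sub>L (real ^ 'm)" and b :: "real ^ 'm" and c :: "'a \<Rightarrow>\<^sub>L real"
  assumes "proper_cone K"
    and "normal_barrier K \<nu> F"
    and "b \<noteq> 0"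
    and "inj (\<lambda>(y, \<tau>). adj A y + \<tau> *\<^sub>R c :: 'a \<Rightarrow>\<^sub>L real)"
    and "\<exists>x y s. x \<in> interior K \<and> s \<in> interior (dual_cone K) \<and> A x = b \<and> s + adj A y = c"
    and "0 < t"
  shows "(lambda_g F A (primal_path K F A b c t))\<^sup>2
       + (lambda_zeta K F A c (fst (dual_path K F A b c t)))\<^sup>2 = \<nu>"
proof -
  interpret cone_barrier K F \<nu> by unfold_locales fact+
  obtain x0 y0 s0 where feas: "x0 \<in> interior K" "A x0 = b"
    "s0 \<in> interior (dual_cone K)" "s0 + adj A y0 = c"
    using assms(5) by blast
  define x where "x = primal_path K F A b c t"
  note path = primal_path_minimizes[OF feas \<open>0 < t\<close>, folded x_def]
  have tx: "t *\<^sub>R x \<in> interior K" using interior_scale path(1) \<open>0 < t\<close> .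
  obtain y where "c - adj A y = - grad (t *\<^sub>R x)"
    using primal_path_stationary[OF path(1,2) \<open>0 < t\<close> path(3)] by blast
  then have y: "c - adj A (fst (dual_path K F A b c t)) = - grad (t *\<^sub>R x)"
    by (rule dual_path_eq[OF path(1,2) \<open>0 < t\<close>])
  have "inj (adj A)"
  proof (rule injI)
    fix u v assume "adj A u = adj A v"
    then show "u = v" using injD[OF assms(4), of "(u, 0)" "(v, 0)"] by simp
  qed
  from lambda_zeta_eq[OF tx this y] obtain p z where "A p = A (t *\<^sub>R x)" "hess (t *\<^sub>R x) p = adj A z"
    and \<zeta>: "(lambda_zeta K F A c (fst (dual_path K F A b c t)))\<^sup>2 = hess (t *\<^sub>R x) p p" .
  from decrement_decomposition[OF tx this(1,2)] show ?thesis
    using lambda_g_scale[OF path(1) \<open>0 < t\<close>, of A] \<zeta> by (simp add: x_def)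
qed

end
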